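(* Let $1<p<\infty$, let $m$ be a positive integer, and let $Q^m:l_p\to l_p$ be the $m$-th power operator $Q^m(x)=\{t_n^m\}_{n=1}^\infty$ for $x=\{t_n\}_{n=1}^\infty\in l_p$. Then $Q^m$ is Fréchet differentiable on $l_p$, and for every $\bar x=\{\bar t_n\}_{n=1}^\infty\in l_p$ the Fréchet derivative $\nabla(Q^m)(\bar x):l_p\to l_p$ satisfies: (i) If $m>1$, then $\nabla(Q^m)(\bar x)$ is the pointwise multiplication operator (represented by the infinite diagonal matrix with diagonal entries $m\bar t_1^{m-1},m\bar t_2^{m-1},\dots$) given by $$\nabla(Q^m)(\bar x)(x)=\{m\bar t_n^{\,m-1}t_n\}_{n=1}^\infty\in l_p\quad\text{for every } x=\{t_n\}_{n=1}^\infty\in l_p.$$ (ii) If $m=1$, then $\nabla(Q^1)(\bar x)$ is the identity mapping on $l_p$: $\nabla(Q^1)(\bar x)(x)=x$ for every $x\in l_p$.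
   Context: $l_p$ is the Banach space of real sequences $x=\{t_n\}_{n=1}^\infty$ with $\|x\|_p=(\sum_n|t_n|^p)^{1/p}<\infty$ and origin $\theta_p$. A map $T:l_p\to l_p$ is Fréchet differentiable at $\bar x$ with derivative $\nabla T(\bar x)$ if $\nabla T(\bar x):l_p\to l_p$ is continuous linear and $\lim_{u\to\theta_p}\frac{T(\bar x+u)-T(\bar x)-\nabla T(\bar x)(u)}{\|u\|_p}=\theta_p$; Fréchet differentiable on $l_p$ means at every point. *)

theory Defs
  imports "HOL-Analysis.Analysis"
begin

text \<open>
  Real sequences are functions on \<open>nat\<close>, so the sequence written \<open>t_1, t_2, \<dots>\<close> in the
  literature is \<open>x 0, x 1, \<dots>\<close> here.  The exponent \<open>p\<close> is a real number, hence \<open>l_p\<close> is a carrier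
  set rather than a type.
\<close>

definition lp :: "real \<Rightarrow> (nat \<Rightarrow> real) set" where
  "lp p = {x. summable (\<lambda>n. \<bar>x n\<bar> powr p)}"

definition lp_norm :: "real \<Rightarrow> (nat \<Rightarrow> real) \<Rightarrow> real" where
  "lp_norm p x = (\<Sum>n. \<bar>x n\<bar> powr p) powr (1 / p)"

definition lp_zero :: "nat \<Rightarrow> real" where
  "lp_zero = (\<lambda>n. 0)"

definition lp_dist :: "real \<Rightarrow> (nat \<Rightarrow> real) \<Rightarrow> (nat \<Rightarrow> real) \<Rightarrow> real" where
  "lp_dist p x y = lp_norm p (\<lambda>n. x n - y n)"

text \<open>The norm topology; \<open>Metric_space_lp\<close> below shows that \<open>lp_dist p\<close> is a metric on \<open>lp p\<close>.\<close>

definition lp_topology :: "real \<Rightarrow> (nat \<Rightarrow> real) topology" where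
  "lp_topology p = Metric_space.mtopology (lp p) (lp_dist p)"

definition lp_continuous_linear :: "real \<Rightarrow> ((nat \<Rightarrow> real) \<Rightarrow> (nat \<Rightarrow> real)) \<Rightarrow> bool" where
  "lp_continuous_linear p A \<longleftrightarrow>
     A \<in> lp p \<rightarrow> lp p \<and>
     (\<forall>x\<in>lp p. \<forall>y\<in>lp p. A (\<lambda>n. x n + y n) = (\<lambda>n. A x n + A y n)) \<and>
     (\<forall>c. \<forall>x\<in>lp p. A (\<lambda>n. c * x n) = (\<lambda>n. c * A x n)) \<and>
     continuous_map (lp_topology p) (lp_topology p) A"

definition lp_has_frechet_derivative ::
  "real \<Rightarrow> ((nat \<Rightarrow> real) \<Rightarrow> (nat \<Rightarrow> real)) \<Rightarrow> ((nat \<Rightarrow> real) \<Rightarrow> (nat \<Rightarrow> real)) \<Rightarrow> (nat \<Rightarrow> real) \<Rightarrow> bool" where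
  "lp_has_frechet_derivative p T A xbar \<longleftrightarrow>
     lp_continuous_linear p A \<and>
     limitin (lp_topology p)
       (\<lambda>u n. (T (\<lambda>k. xbar k + u k) n - T xbar n - A u n) / lp_norm p u)
       lp_zero (atin (lp_topology p) lp_zero)"

definition lp_frechet_differentiable ::
  "real \<Rightarrow> ((nat \<Rightarrow> real) \<Rightarrow> (nat \<Rightarrow> real)) \<Rightarrow> (nat \<Rightarrow> real) \<Rightarrow> bool" where
  "lp_frechet_differentiable p T xbar \<longleftrightarrow> (\<exists>A. lp_has_frechet_derivative p T A xbar)"

text \<open>As with the library's \<open>frechet_derivative\<close>, the derivative is obtained by choice.  It is a
  function on all sequences, and its values are meaningful on \<open>lp p\<close> only.\<close>

definition lp_frechet_derivative ::
  "real \<Rightarrow> ((nat \<Rightarrow> real) \<Rightarrow> (nat \<Rightarrow> real)) \<Rightarrow> (nat \<Rightarrow> real) \<Rightarrow> ((nat \<Rightarrow> real) \<Rightarrow> (nat \<Rightarrow> real))" where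
  "lp_frechet_derivative p T xbar = (SOME A. lp_has_frechet_derivative p T A xbar)"

definition power_operator :: "nat \<Rightarrow> (nat \<Rightarrow> real) \<Rightarrow> (nat \<Rightarrow> real)" where
  "power_operator m x = (\<lambda>n. x n ^ m)"

definition diagonal_matrix :: "(nat \<Rightarrow> real) \<Rightarrow> nat \<Rightarrow> nat \<Rightarrow> real" where
  "diagonal_matrix d i j = (if i = j then d i else 0)"

definition lp_represented_by_matrix ::
  "real \<Rightarrow> ((nat \<Rightarrow> real) \<Rightarrow> (nat \<Rightarrow> real)) \<Rightarrow> (nat \<Rightarrow> nat \<Rightarrow> real) \<Rightarrow> bool" where
  "lp_represented_by_matrix p A M \<longleftrightarrow> (\<forall>x\<in>lp p. \<forall>i. (\<lambda>j. M i j * x j) sums A x i)"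


lemma powr_convex_nonneg:
  fixes p l u v :: real
  assumes p: "1 \<le> p" and l: "0 \<le> l" "l \<le> 1" and uv: "0 \<le> u" "0 \<le> v"
  shows "(l * u + (1 - l) * v) powr p \<le> l * u powr p + (1 - l) * v powr p"
proof -
  have shrink: "(a * b) powr p \<le> a * b powr p" if "0 \<le> a" "a \<le> 1" "0 \<le> b" for a b :: real
  proof -
    have "a powr p \<le> a"
      using powr_mono'[of 1 p a] that p by (cases "a = 0") auto
    thus ?thesis using that by (simp add: powr_mult mult_right_mono)
  qed
  consider "u = 0" | "v = 0" | "u > 0" "v > 0" using uv by fastforce
  thus ?thesis
  proof cases
    case 1 thus ?thesis using shrink[of "1 - l" v] l uv by simp
  next
    case 2 thus ?thesis using shrink[of l u] l uv by simp
  next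
    case 3
    thus ?thesis
      using convex_onD[OF powr_convex[OF p], of "1 - l" u v] l by simp
  qed
qed

lemma lp_norm_nonneg: "0 \<le> lp_norm p x"
  by (simp add: lp_norm_def)

lemma lp_norm_powr:
  assumes "1 \<le> p" "x \<in> lp p"
  shows "lp_norm p x powr p = (\<Sum>n. \<bar>x n\<bar> powr p)"
  using assms by (simp add: lp_norm_def lp_def powr_powr suminf_nonneg)

lemma lp_norm_eq_0:
  assumes "1 \<le> p" "x \<in> lp p"
  shows "lp_norm p x = 0 \<longleftrightarrow> x = (\<lambda>n. 0)"
  using assms suminf_eq_zero_iff[of "\<lambda>n. \<bar>x n\<bar> powr p"]
  by (auto simp: lp_norm_def lp_def)

lemma lp_minkowski:
  assumes p: "1 \<le> p" and x: "x \<in> lp p" and y: "y \<in> lp p"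
  shows "(\<lambda>n. x n + y n) \<in> lp p"
    and "lp_norm p (\<lambda>n. x n + y n) \<le> lp_norm p x + lp_norm p y"
proof -
  define a b where "a = lp_norm p x" and "b = lp_norm p y"
  have "(\<lambda>n. x n + y n) \<in> lp p \<and> lp_norm p (\<lambda>n. x n + y n) \<le> a + b"
  proof (cases "a = 0 \<or> b = 0")
    case True
    thus ?thesis
      using lp_norm_eq_0[OF p x] lp_norm_eq_0[OF p y] x y by (auto simp: a_def b_def lp_norm_nonneg)
  next
    case False
    hence ab: "a > 0" "b > 0"
      using lp_norm_nonneg[of p x] lp_norm_nonneg[of p y] by (auto simp: a_def b_def)
    define l where "l = a / (a + b)"
    have l: "0 \<le> l" "l \<le> 1" "1 - l = b / (a + b)" using ab by (auto simp: l_def field_simps)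
    define g where
      "g = (\<lambda>n. (a + b) powr p * (l * (\<bar>x n\<bar> powr p / a powr p) + (1 - l) * (\<bar>y n\<bar> powr p / b powr p)))"
    have le: "\<bar>x n + y n\<bar> powr p \<le> g n" for n
    proof -
      have "\<bar>x n + y n\<bar> powr p \<le> (\<bar>x n\<bar> + \<bar>y n\<bar>) powr p"
        by (rule powr_mono2) (use p in auto)
      also have "\<bar>x n\<bar> + \<bar>y n\<bar> = (a + b) * (l * (\<bar>x n\<bar> / a) + (1 - l) * (\<bar>y n\<bar> / b))"
        unfolding l(3) unfolding l_def using ab by (simp add: divide_simps)
      also have "\<dots> powr p = (a + b) powr p * (l * (\<bar>x n\<bar> / a) + (1 - l) * (\<bar>y n\<bar> / b)) powr p"
        by (rule powr_mult)
      also have "\<dots> \<le> (a + b) powr p * (l * (\<bar>x n\<bar> / a) powr p + (1 - l) * (\<bar>y n\<bar> / b) powr p)"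
        using ab l(1,2) p by (intro mult_left_mono powr_convex_nonneg) auto
      also have "\<dots> = g n"
        using ab by (simp add: g_def powr_divide)
      finally show ?thesis .
    qed
    have sx: "(\<lambda>n. \<bar>x n\<bar> powr p) sums (a powr p)"
      using x lp_norm_powr[OF p x] by (simp add: a_def lp_def summable_sums)
    have sy: "(\<lambda>n. \<bar>y n\<bar> powr p) sums (b powr p)"
      using y lp_norm_powr[OF p y] by (simp add: b_def lp_def summable_sums)
    have "g sums ((a + b) powr p * (l * (a powr p / a powr p) + (1 - l) * (b powr p / b powr p)))"
      unfolding g_def by (intro sums_mult sums_add sums_divide sx sy)
    hence g: "g sums ((a + b) powr p)" using ab by simp
    have sm: "summable (\<lambda>n. \<bar>x n + y n\<bar> powr p)"
      by (rule summable_comparison_test'[OF sums_summable[OF g], of 0]) (use le in auto)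
    have "(\<Sum>n. \<bar>x n + y n\<bar> powr p) \<le> (a + b) powr p"
      using suminf_le[OF le sm sums_summable[OF g]] sums_unique[OF g] by simp
    hence "lp_norm p (\<lambda>n. x n + y n) \<le> ((a + b) powr p) powr (1 / p)"
      unfolding lp_norm_def using p sm by (intro powr_mono2) (auto intro: suminf_nonneg)
    thus ?thesis using sm ab p by (simp add: lp_def powr_powr)
  qed
  thus "(\<lambda>n. x n + y n) \<in> lp p" "lp_norm p (\<lambda>n. x n + y n) \<le> lp_norm p x + lp_norm p y"
    by (auto simp: a_def b_def)
qed

lemma lp_diff:
  assumes "1 \<le> p" "x \<in> lp p" "y \<in> lp p"
  shows "(\<lambda>n. x n - y n) \<in> lp p"
  using lp_minkowski(1)[of p x "\<lambda>n. - y n"] assms by (simp add: lp_def)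

lemma Metric_space_lp:
  assumes "1 \<le> p"
  shows "Metric_space (lp p) (lp_dist p)"
proof
  show "0 \<le> lp_dist p x y" for x y by (simp add: lp_dist_def lp_norm_nonneg)
  show "lp_dist p x y = lp_dist p y x" for x y
    by (simp add: lp_dist_def lp_norm_def abs_minus_commute)
  show "lp_dist p x y = 0 \<longleftrightarrow> x = y" if "x \<in> lp p" "y \<in> lp p" for x y
    using lp_norm_eq_0[OF assms lp_diff[OF assms that]] by (auto simp: lp_dist_def fun_eq_iff)
  show "lp_dist p x z \<le> lp_dist p x y + lp_dist p y z"
    if "x \<in> lp p" "y \<in> lp p" "z \<in> lp p" for x y z
    using lp_minkowski(2)[OF assms lp_diff[OF assms that(1,2)] lp_diff[OF assms that(2,3)]]
    by (simp add: lp_dist_def)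
qed

end

theory Submission
  imports Defs
begin

text \<open>
  The remainder \<open>(t + u)^m - t^m - m t^(m-1) u\<close> is at most \<open>K u\<^sup>2\<close> with \<open>K\<close> uniform over
  \<open>\<bar>t\<bar> \<le> B\<close>, \<open>\<bar>u\<bar> \<le> 1\<close>.  Entries of a sequence in \<open>l_p\<close> are bounded by its norm, so the
  remainder of \<open>Q^m\<close> at \<open>xbar\<close> is dominated entrywise by \<open>K \<parallel>u\<parallel> \<bar>u n\<bar>\<close> and has norm at most
  \<open>K \<parallel>u\<parallel>\<^sup>2\<close>.  Since derivatives are obtained by choice, their uniqueness on \<open>l_p\<close> is needed as
  well; it follows by testing two candidates on small multiples of a fixed sequence.
\<close>

section \<open>Entrywise bounds and scaling in \<open>lp p\<close>\<close>

lemma abs_le_lp_norm: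
  assumes "1 \<le> p" "x \<in> lp p"
  shows "\<bar>x n\<bar> \<le> lp_norm p x"
proof -
  have "\<bar>x n\<bar> powr p \<le> lp_norm p x powr p"
    using sum_le_suminf[of "\<lambda>n. \<bar>x n\<bar> powr p" "{n}"] assms lp_norm_powr[OF assms]
    by (simp add: lp_def)
  thus ?thesis
    using powr_less_mono2[of p "lp_norm p x" "\<bar>x n\<bar>"] assms lp_norm_nonneg[of p x]
    by linarith
qed

text \<open>Comparison test for the series of \<open>p\<close>-th powers. Since \<open>lp p\<close>
  is only a set of sequences, membership has to be shown each time; this lemma gives it together
  with the norm estimate.\<close>

lemma lp_dominated:
  assumes p: "1 \<le> p" and x: "x \<in> lp p" and c: "0 \<le> c" and le: "\<And>n. \<bar>y n\<bar> \<le> c * \<bar>x n\<bar>"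
  shows "y \<in> lp p" and "lp_norm p y \<le> c * lp_norm p x"
proof -
  have "\<bar>y n\<bar> powr p \<le> c powr p * \<bar>x n\<bar> powr p" for n
    using powr_mono2[OF _ _ le[of n], of p] p by (simp add: powr_mult)
  moreover have sx: "summable (\<lambda>n. c powr p * \<bar>x n\<bar> powr p)"
    using x by (simp add: lp_def summable_mult)
  ultimately have sy: "summable (\<lambda>n. \<bar>y n\<bar> powr p)"
    and "(\<Sum>n. \<bar>y n\<bar> powr p) \<le> (\<Sum>n. c powr p * \<bar>x n\<bar> powr p)"
    by (auto intro!: summable_comparison_test'[OF sx, of 0] suminf_le)
  hence "(\<Sum>n. \<bar>y n\<bar> powr p) \<le> c powr p * lp_norm p x powr p"
    using x lp_norm_powr[OF p x] by (simp add: lp_def suminf_mult)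
  hence "lp_norm p y \<le> ((c * lp_norm p x) powr p) powr (1 / p)"
    unfolding lp_norm_def[of p y] using p sy
    by (intro powr_mono2) (auto intro: suminf_nonneg simp: powr_mult)
  thus "lp_norm p y \<le> c * lp_norm p x"
    using p c lp_norm_nonneg[of p x] by (simp add: powr_powr)
  show "y \<in> lp p" using sy by (simp add: lp_def)
qed

lemma lp_scale:
  assumes p: "1 \<le> p" and x: "x \<in> lp p"
  shows "(\<lambda>n. c * x n) \<in> lp p" and "lp_norm p (\<lambda>n. c * x n) = \<bar>c\<bar> * lp_norm p x"
proof -
  show cx: "(\<lambda>n. c * x n) \<in> lp p"
    by (rule lp_dominated[OF p x, of "\<bar>c\<bar>"]) (simp_all add: abs_mult)
  show "lp_norm p (\<lambda>n. c * x n) = \<bar>c\<bar> * lp_norm p x"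
  proof (cases "c = 0")
    case False
    have "lp_norm p (\<lambda>n. c * x n) \<le> \<bar>c\<bar> * lp_norm p x"
      by (rule lp_dominated(2)[OF p x]) (simp_all add: abs_mult)
    \<comment> \<open>The reverse inequality is domination again, with \<open>x\<close> recovered
      from \<open>c * x\<close> by the factor \<open>inverse \<bar>c\<bar>\<close>.\<close>
    moreover have "lp_norm p x \<le> inverse \<bar>c\<bar> * lp_norm p (\<lambda>n. c * x n)"
      by (rule lp_dominated(2)[OF p cx]) (use False in \<open>simp_all add: abs_mult flip: mult.assoc\<close>)
    ultimately show ?thesis using False by (simp add: field_simps)
  qed (use p in \<open>simp add: lp_norm_def\<close>)
qed

section \<open>Limits, continuity and derivatives in terms of the norm\<close>

lemma lp_zero_in_lp: "lp_zero \<in> lp p"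
  by (simp add: lp_def lp_zero_def)

lemma lp_dist_zero: "lp_dist p u lp_zero = lp_norm p u"
  by (simp add: lp_dist_def lp_zero_def)

text \<open>\<open>atin\<close> is the punctured neighbourhood filter, hence the condition
  \<open>0 < lp_dist p u a\<close>. Convergence in the metric topology also demands that the values
  eventually lie in the carrier.\<close>

lemma limitin_lp_atin_iff:
  assumes p: "1 \<le> p" and a: "a \<in> lp p" and l: "l \<in> lp p"
  shows "limitin (lp_topology p) f l (atin (lp_topology p) a) \<longleftrightarrow>
    (\<forall>e>0. \<exists>d>0. \<forall>u\<in>lp p. 0 < lp_dist p u a \<longrightarrow> lp_dist p u a < d \<longrightarrow>
       f u \<in> lp p \<and> lp_dist p (f u) l < e)"
proof -
  interpret Metric_space "lp p" "lp_dist p" by (rule Metric_space_lp[OF p])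
  show ?thesis
    unfolding lp_topology_def limitin_metric eventually_atin_metric using a l by (simp only: Ball_def imp_conjL simp_thms)
qed

lemma lp_has_frechet_derivative_iff:
  assumes p: "1 \<le> p"
  shows "lp_has_frechet_derivative p T A xbar \<longleftrightarrow> lp_continuous_linear p A \<and>
    (\<forall>e>0. \<exists>d>0. \<forall>u\<in>lp p. 0 < lp_norm p u \<longrightarrow> lp_norm p u < d \<longrightarrow>
       (\<lambda>n. (T (\<lambda>k. xbar k + u k) n - T xbar n - A u n) / lp_norm p u) \<in> lp p \<and>
       lp_norm p (\<lambda>n. (T (\<lambda>k. xbar k + u k) n - T xbar n - A u n) / lp_norm p u) < e)"
  unfolding lp_has_frechet_derivative_def
    limitin_lp_atin_iff[OF p lp_zero_in_lp lp_zero_in_lp] lp_dist_zero ..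

text \<open>A bounded diagonal gives a Lipschitz map with constant \<open>C\<close>; continuity is
  then checked as a limit at each point.\<close>

lemma lp_continuous_linear_mult:
  assumes p: "1 \<le> p" and C: "\<And>n. \<bar>d n\<bar> \<le> C"
  shows "lp_continuous_linear p (\<lambda>x n. d n * x n)"
proof -
  interpret Metric_space "lp p" "lp_dist p" by (rule Metric_space_lp[OF p])
  have C0: "0 \<le> C" using C[of 0] by linarith
  have le: "\<bar>d n * x\<bar> \<le> C * \<bar>x\<bar>" for n x
    by (simp add: abs_mult C mult_right_mono)
  have into: "(\<lambda>n. d n * x n) \<in> lp p" if "x \<in> lp p" for x
    using lp_dominated(1)[OF p that C0 le] .
  have lipschitz: "lp_dist p (\<lambda>n. d n * x n) (\<lambda>n. d n * y n) \<le> C * lp_dist p x y"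
    if "x \<in> lp p" "y \<in> lp p" for x y
    using lp_dominated(2)[OF p lp_diff[OF p that] C0 le]
    by (simp add: lp_dist_def right_diff_distrib)
  have "limitin (lp_topology p) (\<lambda>x n. d n * x n) (\<lambda>n. d n * a n) (atin (lp_topology p) a)"
    if a: "a \<in> lp p" for a
    unfolding limitin_lp_atin_iff[OF p a into[OF a]]
  proof (intro allI impI)
    fix e :: real assume e: "e > 0"
    \<comment> \<open>The radius uses \<open>C + 1\<close> because \<open>C\<close> may be
      zero.\<close>
    have "lp_dist p (\<lambda>n. d n * u n) (\<lambda>n. d n * a n) < e"
      if "u \<in> lp p" "lp_dist p u a < e / (C + 1)" for u
    proof -
      have "lp_dist p (\<lambda>n. d n * u n) (\<lambda>n. d n * a n) \<le> (C + 1) * lp_dist p u a"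
        using lipschitz[OF that(1) a] nonneg[of u a] unfolding distrib_right by linarith
      also have "\<dots> < e" using that(2) C0 by (simp add: field_simps)
      finally show ?thesis .
    qed
    thus "\<exists>r>0. \<forall>u\<in>lp p. 0 < lp_dist p u a \<longrightarrow> lp_dist p u a < r \<longrightarrow>
        (\<lambda>n. d n * u n) \<in> lp p \<and> lp_dist p (\<lambda>n. d n * u n) (\<lambda>n. d n * a n) < e"
      using e C0 into by (intro exI[of _ "e / (C + 1)"]) auto
  qed
  hence "continuous_map (lp_topology p) (lp_topology p) (\<lambda>x n. d n * x n)"
    by (simp add: continuous_map_atin lp_topology_def)
  thus ?thesis
    using into by (auto simp: lp_continuous_linear_def algebra_simps)
qed

text \<open>By homogeneity, the difference of the two quotients at \<open>c * x\<close> does not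
  depend on \<open>c > 0\<close>, yet it is arbitrarily small for small \<open>c\<close>. Comparing
  single entries suffices, as they are bounded by the norm.\<close>

lemma lp_has_frechet_derivative_unique:
  assumes p: "1 \<le> p" and A: "lp_has_frechet_derivative p T A xbar"
    and B: "lp_has_frechet_derivative p T B xbar" and x: "x \<in> lp p"
  shows "A x = B x"
proof
  fix n
  have scaled: "A (\<lambda>k. c * x k) n = c * A x n" "B (\<lambda>k. c * x k) n = c * B x n" for c
    using A B x by (auto simp: lp_has_frechet_derivative_def lp_continuous_linear_def)
  show "A x n = B x n"
  proof (cases "lp_norm p x = 0")
    case True
    hence "(\<lambda>k. 0 * x k) = x" using lp_norm_eq_0[OF p x] by simp
    thus ?thesis using scaled[of 0] by simp
  next
    case False
    define N where "N = lp_norm p x"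
    have N: "N > 0" using False lp_norm_nonneg[of p x] by (simp add: N_def)
    \<comment> \<open>The factor 2 absorbs the two errors \<open>e\<close>, one per candidate;
      \<open>0 + e\<close> is the shape that \<open>field_le_epsilon\<close> expects.\<close>
    have "\<bar>A x n - B x n\<bar> / (2 * N) \<le> 0 + e" if e: "e > 0" for e
    proof -
      obtain d1 where d1: "d1 > 0" "\<And>u. \<lbrakk>u \<in> lp p; 0 < lp_norm p u; lp_norm p u < d1\<rbrakk> \<Longrightarrow>
          (\<lambda>n. (T (\<lambda>k. xbar k + u k) n - T xbar n - A u n) / lp_norm p u) \<in> lp p \<and>
          lp_norm p (\<lambda>n. (T (\<lambda>k. xbar k + u k) n - T xbar n - A u n) / lp_norm p u) < e"
        using A e unfolding lp_has_frechet_derivative_iff[OF p] by blast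
      obtain d2 where d2: "d2 > 0" "\<And>u. \<lbrakk>u \<in> lp p; 0 < lp_norm p u; lp_norm p u < d2\<rbrakk> \<Longrightarrow>
          (\<lambda>n. (T (\<lambda>k. xbar k + u k) n - T xbar n - B u n) / lp_norm p u) \<in> lp p \<and>
          lp_norm p (\<lambda>n. (T (\<lambda>k. xbar k + u k) n - T xbar n - B u n) / lp_norm p u) < e"
        using B e unfolding lp_has_frechet_derivative_iff[OF p] by blast
      \<comment> \<open>Chosen so that \<open>c * x\<close> has norm \<open>min d1 d2 / 2\<close>,
        inside both radii.\<close>
      define c where "c = min d1 d2 / (2 * N)"
      define u where "u = (\<lambda>k. c * x k)"
      have c: "c > 0" using d1(1) d2(1) N by (simp add: c_def)
      have u: "u \<in> lp p" "lp_norm p u = c * N"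
        using lp_scale[OF p x, of c] c by (simp_all add: u_def N_def)
      have "0 < lp_norm p u" "lp_norm p u < d1" "lp_norm p u < d2"
        using c N d1(1) d2(1) by (auto simp: u(2)) (auto simp: c_def min_def)
      hence "\<bar>(T (\<lambda>k. xbar k + u k) n - T xbar n - A u n) / (c * N)\<bar> < e"
        and "\<bar>(T (\<lambda>k. xbar k + u k) n - T xbar n - B u n) / (c * N)\<bar> < e"
        using d1(2)[OF u(1)] d2(2)[OF u(1)] abs_le_lp_norm[OF p] u(2)
        by (metis (no_types, lifting) order_le_less_trans)+
      \<comment> \<open>Subtracting the quotients cancels all terms in \<open>T\<close>.\<close>
      hence "\<bar>(T (\<lambda>k. xbar k + u k) n - T xbar n - B u n) / (c * N) -
          (T (\<lambda>k. xbar k + u k) n - T xbar n - A u n) / (c * N)\<bar> < e + e"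
        by (rule order_le_less_trans[OF abs_triangle_ineq4 add_strict_mono, rotated])
      hence "\<bar>(A u n - B u n) / (c * N)\<bar> < e + e"
        by (simp flip: diff_divide_distrib)
      moreover have "(A u n - B u n) / (c * N) = (A x n - B x n) / N"
        using c by (simp add: u_def scaled flip: right_diff_distrib)
      ultimately have "\<bar>A x n - B x n\<bar> / N < e + e"
        using N by (metis abs_divide abs_of_pos)
      thus ?thesis using N by (simp add: field_simps)
    qed
    hence "\<bar>A x n - B x n\<bar> / (2 * N) \<le> 0" by (rule field_le_epsilon)
    thus ?thesis using N by (simp add: divide_le_0_iff)
  qed
qed

section \<open>The power operator and its derivative\<close>

lemma power_remainder_bound:
  fixes B :: real
  assumes "0 \<le> B"
  obtains K where "0 \<le> K"
    and "\<And>t u. \<lbrakk>\<bar>t\<bar> \<le> B; \<bar>u\<bar> \<le> 1\<rbrakk> \<Longrightarrow> \<bar>(t + u) ^ m - t ^ m - real m * t ^ (m - 1) * u\<bar> \<le> K * u\<^sup>2"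
proof -
  have "\<exists>K\<ge>0. \<forall>t u. \<bar>t\<bar> \<le> B \<longrightarrow> \<bar>u\<bar> \<le> 1 \<longrightarrow>
      \<bar>(t + u) ^ m - t ^ m - real m * t ^ (m - 1) * u\<bar> \<le> K * u\<^sup>2"
  proof (induction m)
    case 0
    show ?case by (intro exI[of _ 0]) auto
  next
    case (Suc m)
    then obtain K where K: "0 \<le> K" "\<And>t u. \<lbrakk>\<bar>t\<bar> \<le> B; \<bar>u\<bar> \<le> 1\<rbrakk> \<Longrightarrow>
        \<bar>(t + u) ^ m - t ^ m - real m * t ^ (m - 1) * u\<bar> \<le> K * u\<^sup>2"
      by blast
    have "\<bar>(t + u) ^ Suc m - t ^ Suc m - real (Suc m) * t ^ m * u\<bar> \<le>
        ((B + 1) * K + real m * B ^ (m - 1)) * u\<^sup>2" if t: "\<bar>t\<bar> \<le> B" and u: "\<bar>u\<bar> \<le> 1" for t u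
    proof -
      \<comment> \<open>The remainder for \<open>Suc m\<close> is \<open>t + u\<close> times the
        remainder for \<open>m\<close> plus a term in \<open>u\<^sup>2\<close>, which dictates the
        new constant. The case split handles the truncated \<open>m - 1\<close> at
        \<open>m = 0\<close>.\<close>
      have eq: "(t + u) ^ Suc m - t ^ Suc m - real (Suc m) * t ^ m * u =
          (t + u) * ((t + u) ^ m - t ^ m - real m * t ^ (m - 1) * u) + real m * t ^ (m - 1) * u\<^sup>2"
        by (cases m) (simp_all add: algebra_simps power2_eq_square)
      have "\<bar>(t + u) * ((t + u) ^ m - t ^ m - real m * t ^ (m - 1) * u)\<bar> \<le> (B + 1) * K * u\<^sup>2"
        unfolding abs_mult[of "t + u"] mult.assoc[of "B + 1"] using K(2)[OF t u] t u assms by (intro mult_mono) auto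
      moreover have "\<bar>real m * t ^ (m - 1) * u\<^sup>2\<bar> \<le> real m * B ^ (m - 1) * u\<^sup>2"
        using t by (auto simp: abs_mult power_abs intro!: mult_right_mono mult_left_mono power_mono)
      ultimately show ?thesis
        unfolding eq distrib_right[of "(B + 1) * K"]
        by (rule order_trans[OF abs_triangle_ineq add_mono])
    qed
    thus ?case
      using K(1) assms by (intro exI[of _ "(B + 1) * K + real m * B ^ (m - 1)"]) auto
  qed
  thus ?thesis using that by blast
qed

text \<open>All but one of the \<open>m\<close> factors of an entry are bounded by the norm; the
  remaining one keeps the sequence \<open>p\<close>-summable.\<close>

lemma power_operator_in_lp:
  assumes p: "1 \<le> p" and m: "0 < m" and x: "x \<in> lp p"
  shows "power_operator m x \<in> lp p"
proof (rule lp_dominated(1)[OF p x])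
  show "0 \<le> lp_norm p x ^ (m - 1)" by (simp add: lp_norm_nonneg)
  show "\<bar>power_operator m x n\<bar> \<le> lp_norm p x ^ (m - 1) * \<bar>x n\<bar>" for n
    using m abs_le_lp_norm[OF p x, of n]
    by (cases m) (auto simp: power_operator_def abs_mult power_abs mult.commute
        intro!: mult_left_mono power_mono)
qed

lemma power_operator_has_frechet_derivative:
  assumes p: "1 \<le> p" and xbar: "xbar \<in> lp p"
  shows "lp_has_frechet_derivative p (power_operator m) (\<lambda>x n. real m * xbar n ^ (m - 1) * x n) xbar"
  unfolding lp_has_frechet_derivative_iff[OF p]
proof (intro conjI allI impI)
  define B where "B = lp_norm p xbar"
  have B: "0 \<le> B" "\<bar>xbar n\<bar> \<le> B" for n
    using lp_norm_nonneg abs_le_lp_norm[OF p xbar] by (auto simp: B_def)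
  show "lp_continuous_linear p (\<lambda>x n. real m * xbar n ^ (m - 1) * x n)"
  proof (rule lp_continuous_linear_mult[OF p])
    show "\<bar>real m * xbar n ^ (m - 1)\<bar> \<le> real m * B ^ (m - 1)" for n
      using B by (auto simp: abs_mult power_abs intro!: mult_left_mono power_mono)
  qed
  fix e :: real assume e: "e > 0"
  obtain K where K: "0 \<le> K" "\<And>t u. \<lbrakk>\<bar>t\<bar> \<le> B; \<bar>u\<bar> \<le> 1\<rbrakk> \<Longrightarrow>
      \<bar>(t + u) ^ m - t ^ m - real m * t ^ (m - 1) * u\<bar> \<le> K * u\<^sup>2"
    using power_remainder_bound[OF B(1), where m = m] by blast
  define r where "r = (\<lambda>u n. (power_operator m (\<lambda>k. xbar k + u k) n - power_operator m xbar n -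
      real m * xbar n ^ (m - 1) * u n) / lp_norm p u)"
  have "r u \<in> lp p \<and> lp_norm p (r u) < e"
    \<comment> \<open>The bound 1 makes every entry of \<open>u\<close> admissible for
      \<open>K\<close>; the bound \<open>e / (K + 1)\<close> makes \<open>K * lp_norm p u\<close>
      smaller than \<open>e\<close>, also when \<open>K = 0\<close>.\<close>
    if u: "u \<in> lp p" "0 < lp_norm p u" "lp_norm p u < min 1 (e / (K + 1))" for u
  proof -
    have "\<bar>r u n\<bar> \<le> K * \<bar>u n\<bar>" for n
    proof -
      have un: "\<bar>u n\<bar> \<le> lp_norm p u" by (rule abs_le_lp_norm[OF p u(1)])
      have "\<bar>r u n\<bar> * lp_norm p u \<le> K * (u n)\<^sup>2"
        using K(2)[OF B(2), of "u n" n] un u(2,3) by (simp add: r_def power_operator_def)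
      also have "\<dots> = K * \<bar>u n\<bar> * \<bar>u n\<bar>"
        by (simp add: power2_eq_square)
      \<comment> \<open>One factor \<open>\<bar>u n\<bar>\<close> becomes the norm and cancels the
        denominator; the other is kept for domination by \<open>u\<close>.\<close>
      also have "\<dots> \<le> K * \<bar>u n\<bar> * lp_norm p u"
        using K(1) un by (intro mult_left_mono) auto
      finally show ?thesis using u(2) by simp
    qed
    from lp_dominated[OF p u(1) K(1) this]
    have "r u \<in> lp p" and "lp_norm p (r u) \<le> K * lp_norm p u" by simp_all
    moreover have "K * lp_norm p u \<le> (K + 1) * lp_norm p u"
      using u(2) by (simp add: algebra_simps)
    moreover have "(K + 1) * lp_norm p u < e"
      using u(3) K(1) by (simp add: field_simps)
    ultimately show ?thesis by linarith
  qed
  moreover have "0 < min 1 (e / (K + 1))" using e K(1) by simp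
  ultimately show "\<exists>d>0. \<forall>u\<in>lp p. 0 < lp_norm p u \<longrightarrow> lp_norm p u < d \<longrightarrow>
      (\<lambda>n. (power_operator m (\<lambda>k. xbar k + u k) n - power_operator m xbar n -
        real m * xbar n ^ (m - 1) * u n) / lp_norm p u) \<in> lp p \<and>
      lp_norm p (\<lambda>n. (power_operator m (\<lambda>k. xbar k + u k) n - power_operator m xbar n -
        real m * xbar n ^ (m - 1) * u n) / lp_norm p u) < e"
    unfolding r_def by blast
qed

text \<open>Existence makes the chosen operator a derivative, and uniqueness identifies its values
  on \<open>lp p\<close>.\<close>

lemma lp_frechet_derivative_eq:
  assumes "1 \<le> p" "lp_has_frechet_derivative p T A xbar" "x \<in> lp p"
  shows "lp_frechet_derivative p T xbar x = A x"
  unfolding lp_frechet_derivative_def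
  by (rule lp_has_frechet_derivative_unique[OF assms(1) _ assms(2,3)])
    (rule someI[where P = "\<lambda>A. lp_has_frechet_derivative p T A xbar", OF assms(2)])

lemma diagonal_matrix_represents:
  assumes "\<And>x. x \<in> lp p \<Longrightarrow> A x = (\<lambda>n. d n * x n)"
  shows "lp_represented_by_matrix p A (diagonal_matrix d)"
  unfolding lp_represented_by_matrix_def
proof (intro ballI allI)
  fix x i assume x: "x \<in> lp p"
  have "(\<lambda>j. if j = i then d i * x j else 0) sums (d i * x i)"
    by (rule sums_single)
  moreover have "(\<lambda>j. if j = i then d i * x j else 0) = (\<lambda>j. diagonal_matrix d i j * x j)"
    by (auto simp: diagonal_matrix_def)
  ultimately show "(\<lambda>j. diagonal_matrix d i j * x j) sums A x i"
    by (simp add: assms[OF x])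
qed

theorem theorem3p1:
  fixes p :: real and m :: nat
  assumes "1 < p" and "0 < m"
  shows "power_operator m \<in> lp p \<rightarrow> lp p \<and>
    (\<forall>xbar\<in>lp p. lp_frechet_differentiable p (power_operator m) xbar) \<and>
    (\<forall>xbar\<in>lp p.
       (1 < m \<longrightarrow>
          lp_represented_by_matrix p (lp_frechet_derivative p (power_operator m) xbar)
            (diagonal_matrix (\<lambda>n. real m * xbar n ^ (m - 1))) \<and>
          (\<forall>x\<in>lp p.
             lp_frechet_derivative p (power_operator m) xbar x =
               (\<lambda>n. real m * xbar n ^ (m - 1) * x n) \<and>
             (\<lambda>n. real m * xbar n ^ (m - 1) * x n) \<in> lp p)) \<and>
       (m = 1 \<longrightarrow>
          (\<forall>x\<in>lp p. lp_frechet_derivative p (power_operator m) xbar x = x)))"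
proof -
  have p: "1 \<le> p" using assms by simp
  note has = power_operator_has_frechet_derivative[OF p, where m = m]
  have eq: "lp_frechet_derivative p (power_operator m) xbar x = (\<lambda>n. real m * xbar n ^ (m - 1) * x n)"
    if "xbar \<in> lp p" "x \<in> lp p" for xbar x
    using lp_frechet_derivative_eq[OF p has] that by blast
  have mem: "(\<lambda>n. real m * xbar n ^ (m - 1) * x n) \<in> lp p" if "xbar \<in> lp p" "x \<in> lp p" for xbar x
    using has[OF that(1)] that(2)
    by (auto simp: lp_has_frechet_derivative_def lp_continuous_linear_def)
  have "power_operator m \<in> lp p \<rightarrow> lp p"
    using power_operator_in_lp[OF p assms(2)] by blast
  moreover have "\<forall>xbar\<in>lp p. lp_frechet_differentiable p (power_operator m) xbar"
    using has unfolding lp_frechet_differentiable_def by blast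
  \<comment> \<open>For \<open>m = 1\<close> the diagonal entries are \<open>xbar n ^ 0 = 1\<close>,
    also where \<open>xbar n = 0\<close>, so the same formula yields the identity.\<close>
  ultimately show ?thesis
    using eq mem diagonal_matrix_represents[OF eq] by auto
qed

end
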